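(* Let $\epsilon>0$ be a constant independent of $n$ and let $a>0$. Place $n$ sensors on $[0,\infty)$ at the first $n$ arrival times $X_1\le\dots\le X_n$ of a homogeneous Poisson process on $[0,\infty)$ with rate $n$. Consider algorithm $MV_1(n,\frac{1+\epsilon}{n})$: the first sensor stays at $X_1$ and, for $i=2,\dots,n$, the sensor at $X_i$ is moved to $X_1+(1+\epsilon)\frac{i-1}{n}$. Then the expected $a$-total movement of this algorithm is $O(n)$.
   Context: If the $i$-th sensor is displaced by a distance $|m(i)|$, the $a$-total movement is $\sum_{i=1}^n|m(i)|^a$. Asymptotics are as $n\to\infty$ with $a,\epsilon$ fixed. *)

theory Defs
  imports "HOL-Probability.Probability" "HOL-Library.Landau_Symbols"
begin

text \<open>
  A homogeneous Poisson process, given by its counting process: \<open>N t \<omega>\<close> is the number of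
  arrivals in \<open>[0, t]\<close>. Only the values at times \<open>t \<ge> 0\<close> are constrained. The differences below
  are subtractions of natural numbers; they do not truncate, because the paths are nondecreasing.
\<close>

locale poisson_process = prob_space M
  for M :: "'a measure" and rate :: real and N :: "real \<Rightarrow> 'a \<Rightarrow> nat" +
  assumes rate_pos: "rate > 0"
    and measurable_count: "\<And>t. 0 \<le> t \<Longrightarrow> N t \<in> measurable M (count_space UNIV)"
    and count_zero: "\<And>\<omega>. \<omega> \<in> space M \<Longrightarrow> N 0 \<omega> = 0"
    and count_mono: "\<And>\<omega> s t. \<omega> \<in> space M \<Longrightarrow> 0 \<le> s \<Longrightarrow> s \<le> t \<Longrightarrow> N s \<omega> \<le> N t \<omega>"
    and count_right_continuous:
      "\<And>\<omega> t. \<omega> \<in> space M \<Longrightarrow> 0 \<le> t \<Longrightarrow> continuous (at_right t) (\<lambda>s. N s \<omega>)"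
    and indep_increments:
      "\<And>(\<tau> :: nat \<Rightarrow> real) k. 0 \<le> \<tau> 0 \<Longrightarrow> mono \<tau> \<Longrightarrow>
         indep_vars (\<lambda>_. count_space UNIV) (\<lambda>j \<omega>. N (\<tau> (Suc j)) \<omega> - N (\<tau> j) \<omega>) {..<k}"
    and poisson_increments:
      "\<And>s t. 0 \<le> s \<Longrightarrow> s < t \<Longrightarrow>
         distr M (count_space UNIV) (\<lambda>\<omega>. N t \<omega> - N s \<omega>)
           = measure_pmf (poisson_pmf (rate * (t - s)))"

text \<open>
  The time of the \<open>i\<close>-th arrival (\<open>i \<ge> 1\<close>). The set is empty only on the null event that there are
  fewer than \<open>i\<close> arrivals altogether, where the value is an unspecified constant.
\<close>

definition arrival_time :: "(real \<Rightarrow> 'a \<Rightarrow> nat) \<Rightarrow> nat \<Rightarrow> 'a \<Rightarrow> real" where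
  "arrival_time N i \<omega> = Inf {t. 0 \<le> t \<and> i \<le> N t \<omega>}"

text \<open>
  Sensors are numbered from \<open>1\<close>. In \<open>MV1 x X\<close> the argument \<open>X\<close> gives the initial positions of the
  sensors, \<open>x\<close> is the spacing, and the result gives the final positions.
\<close>

definition MV1 :: "real \<Rightarrow> (nat \<Rightarrow> real) \<Rightarrow> nat \<Rightarrow> real" where
  "MV1 x X i = (if i = 1 then X 1 else X 1 + x * (real i - 1))"

definition total_movement :: "real \<Rightarrow> nat \<Rightarrow> (nat \<Rightarrow> real) \<Rightarrow> (nat \<Rightarrow> real) \<Rightarrow> real" where
  "total_movement a n X Y = (\<Sum>i = 1..n. \<bar>Y i - X i\<bar> powr a)"

definition MV1_total_movement ::
    "real \<Rightarrow> nat \<Rightarrow> real \<Rightarrow> (real \<Rightarrow> 'a \<Rightarrow> nat) \<Rightarrow> 'a \<Rightarrow> real" where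
  "MV1_total_movement a n x N \<omega> =
     (let X = (\<lambda>i. arrival_time N i \<omega>) in total_movement a n X (MV1 x X))"

end

theory Submission
  imports Defs
begin

text \<open>
  Since the arrival times increase, every sensor is displaced by at most \<open>1 + \<epsilon> + X\<^sub>n\<close>, whose
  \<open>a\<close>-th power is at most a constant times \<open>exp (X\<^sub>n / 4)\<close>. So it suffices to bound the expectation
  of \<open>exp (X\<^sub>n / 4)\<close> uniformly in \<open>n\<close>. The event \<open>X\<^sub>n > t\<close> means that a Poisson variable with mean
  \<open>n t\<close> is less than \<open>n\<close>, which has probability at most \<open>exp (n (1 - t / 2)) \<le> exp (1 - t / 2)\<close> for
  \<open>t \<ge> 2\<close>; summing over integer \<open>t\<close> gives a convergent geometric series.
\<close>

section \<open>Elementary bounds for powers and for Poisson tails\<close>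

text \<open>This is \<open>ln z \<le> z - 1\<close> at \<open>z = b * y / a\<close>. It trades a
  power of any order \<open>a\<close> for an exponential of any rate \<open>b\<close>, so one
  exponential moment serves every \<open>a\<close>.\<close>

lemma powr_le_exp_mult:
  fixes a b y :: real
  assumes "a > 0" "b > 0" "y > 0"
  shows "y powr a \<le> (a / b) powr a * exp (b * y)"
proof -
  have "ln y - ln (a / b) = ln (b * y / a)"
    using assms by (simp add: ln_div ln_mult)
  also have "\<dots> \<le> b * y / a"
    using assms ln_le_minus_one[of "b * y / a"] by simp
  finally have "a * ln y \<le> a * ln (a / b) + b * y"
    using assms by (simp add: field_simps)
  then show ?thesis
    using assms by (simp add: powr_def exp_add[symmetric])
qed

text \<open>Chernoff's method with base 2: for Poisson \<open>Z\<close> of mean \<open>r\<close>,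
  the probability of \<open>Z < k\<close> is at most 2^k times the expectation of 2^(-Z), which is
  \<open>exp (- r / 2)\<close>. Finally 2 is replaced by \<open>exp 1\<close>.\<close>

lemma poisson_pmf_lower_tail:
  fixes r :: real
  assumes "r > 0"
  shows "measure (measure_pmf (poisson_pmf r)) {..<k} \<le> exp (real k - r / 2)"
proof -
  have sum_half: "(\<Sum>j<k. (r / 2) ^ j / fact j) \<le> exp (r / 2)"
  proof -
    have "(\<Sum>j<k. (r / 2) ^ j /\<^sub>R fact j) \<le> exp (r / 2)"
      unfolding exp_def using assms by (intro sum_le_suminf summable_exp_generic) auto
    moreover have "(r / 2) ^ j /\<^sub>R fact j = (r / 2) ^ j / fact j" for j
      by (metis divide_inverse mult.commute real_scaleR_def)
    ultimately show ?thesis by simp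
  qed
  have "measure (measure_pmf (poisson_pmf r)) {..<k} = (\<Sum>j<k. r ^ j / fact j * exp (-r))"
    using assms by (simp add: measure_measure_pmf_finite)
  also have "\<dots> \<le> (\<Sum>j<k. 2 ^ k * exp (-r) * ((r / 2) ^ j / fact j))"
  proof (rule sum_mono)
    fix j assume "j \<in> {..<k}"
    then have "(2::real) ^ j \<le> 2 ^ k" by (intro power_increasing) auto
    then have "2 ^ j * ((r / 2) ^ j / fact j * exp (-r)) \<le> 2 ^ k * ((r / 2) ^ j / fact j * exp (-r))"
      using assms by (intro mult_right_mono) auto
    then show "r ^ j / fact j * exp (-r) \<le> 2 ^ k * exp (-r) * ((r / 2) ^ j / fact j)"
      by (simp add: power_divide mult_ac)
  qed
  also have "\<dots> = 2 ^ k * exp (-r) * (\<Sum>j<k. (r / 2) ^ j / fact j)"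
    by (simp add: sum_distrib_left)
  also have "\<dots> \<le> exp 1 ^ k * exp (-r) * exp (r / 2)"
    using sum_half exp_ge_add_one_self[of 1] assms
    by (intro mult_mono power_mono) (auto intro!: sum_nonneg)
  also have "\<dots> = exp (real k - r / 2)"
    by (simp add: exp_of_nat_mult[symmetric] exp_add[symmetric] del: exp_of_nat_mult)
  finally show ?thesis .
qed

section \<open>Counts and arrival times of one Poisson process\<close>

context poisson_process
begin

lemma sets_count_less [measurable]:
  "0 \<le> t \<Longrightarrow> {\<omega> \<in> space M. N t \<omega> < i} \<in> sets M"
  using measurable_count[of t] by measurable

lemma sets_count_ge [measurable]:
  "0 \<le> t \<Longrightarrow> {\<omega> \<in> space M. i \<le> N t \<omega>} \<in> sets M"
  using measurable_count[of t] by measurable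

lemma prob_count_less:
  assumes "0 < t"
  shows "prob {\<omega> \<in> space M. N t \<omega> < i} \<le> exp (real i - rate * t / 2)"
proof -
  have "prob {\<omega> \<in> space M. N t \<omega> < i}
      = prob ((\<lambda>\<omega>. N t \<omega> - N 0 \<omega>) -` {..<i} \<inter> space M)"
    by (rule arg_cong[where f = prob]) (auto simp: count_zero)
  also have "\<dots> = measure (distr M (count_space UNIV) (\<lambda>\<omega>. N t \<omega> - N 0 \<omega>)) {..<i}"
    using assms measurable_count[of t] measurable_count[of 0]
    by (intro measure_distr[symmetric]) auto
  also have "\<dots> = measure (measure_pmf (poisson_pmf (rate * t))) {..<i}"
    using assms poisson_increments[of 0 t] by simp
  also have "\<dots> \<le> exp (real i - rate * t / 2)"
    using assms rate_pos by (intro poisson_pmf_lower_tail) simp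
  finally show ?thesis .
qed

text \<open>Borel-Cantelli: the lower tails at integer times are dominated by a geometric series of
  ratio \<open>exp (- (rate / 2))\<close>. Hence the set whose infimum defines
  \<open>arrival_time N i\<close> is almost surely nonempty.\<close>

lemma AE_eventually_count_ge:
  "AE \<omega> in M. \<exists>j::nat. i \<le> N (real j) \<omega>"
proof -
  \<comment> \<open>\<open>Suc j\<close> keeps the time positive, as \<open>prob_count_less\<close>
    requires.\<close>
  let ?A = "\<lambda>j::nat. {\<omega> \<in> space M. N (real (Suc j)) \<omega> < i}"
  have "summable (\<lambda>j. exp (real i - rate / 2) * exp (- (rate / 2)) ^ j)"
    using rate_pos by (intro summable_mult summable_geometric) simp
  then have "summable (\<lambda>j. exp (real i - rate * real (Suc j) / 2))"
    by (simp add: exp_of_nat_mult[symmetric] exp_add[symmetric] algebra_simps add_divide_distrib)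
  then have "summable (\<lambda>j. prob (?A j))"
    by (rule summable_comparison_test'[where N = 0])
      (use prob_count_less in \<open>simp del: of_nat_Suc\<close>)
  then have "AE \<omega> in M. \<forall>\<^sub>F j in sequentially. \<omega> \<in> space M - ?A j"
    by (intro borel_cantelli_AE1) (auto simp: emeasure_eq_measure simp del: of_nat_Suc)
  then show ?thesis
  proof (rule AE_mp, intro AE_I2 impI)
    fix \<omega> assume "\<forall>\<^sub>F j in sequentially. \<omega> \<in> space M - ?A j"
    then obtain j where "\<omega> \<in> space M - ?A j"
      by (auto simp: eventually_sequentially)
    then show "\<exists>j::nat. i \<le> N (real j) \<omega>"
      by (auto simp: not_less simp del: of_nat_Suc)
  qed
qed

text \<open>Paths are nondecreasing, so an arrival time below \<open>y\<close> is already witnessed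
  by a rational time below \<open>y\<close>, which leaves a countable union.\<close>

lemma borel_measurable_arrival_time [measurable]: "arrival_time N i \<in> borel_measurable M"
proof (rule borel_measurableI_less)
  fix y :: real
  let ?B = "{\<omega> \<in> space M. \<exists>q::rat. 0 \<le> real_of_rat q \<and> real_of_rat q < y \<and> i \<le> N (real_of_rat q) \<omega>}"
  let ?E = "{\<omega> \<in> space M. \<exists>j::nat. i \<le> N (real j) \<omega>}"
  \<comment> \<open>Off \<open>?E\<close> the arrival time is the unspecified constant
    \<open>Inf {}\<close>, so the complement of \<open>?E\<close> belongs to the sublevel set
    entirely or not at all.\<close>
  have "arrival_time N i \<omega> < y \<longleftrightarrow>
      \<omega> \<in> (if Inf {} < y then ?B \<union> (space M - ?E) else ?B)" if \<omega>: "\<omega> \<in> space M" for \<omega>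
  proof (cases "\<omega> \<in> ?E")
    case True
    then have ne: "{t. 0 \<le> t \<and> i \<le> N t \<omega>} \<noteq> {}"
      by (auto intro: of_nat_0_le_iff)
    have "arrival_time N i \<omega> < y \<longleftrightarrow> (\<exists>t. 0 \<le> t \<and> i \<le> N t \<omega> \<and> t < y)"
      unfolding arrival_time_def by (subst cInf_less_iff[OF ne]) (auto intro!: bdd_belowI[of _ 0])
    also have "\<dots> \<longleftrightarrow> \<omega> \<in> ?B"
    proof
      assume "\<exists>t. 0 \<le> t \<and> i \<le> N t \<omega> \<and> t < y"
      then obtain t where t: "0 \<le> t" "i \<le> N t \<omega>" "t < y" by blast
      then obtain q where q: "t < real_of_rat q" "real_of_rat q < y"
        using of_rat_dense by blast
      have "N t \<omega> \<le> N (real_of_rat q) \<omega>"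
        using \<omega> t(1) q(1) by (intro count_mono) auto
      then have "0 \<le> real_of_rat q" "i \<le> N (real_of_rat q) \<omega>"
        using t q by linarith+
      with \<omega> q(2) show "\<omega> \<in> ?B" by blast
    next
      assume "\<omega> \<in> ?B"
      then show "\<exists>t. 0 \<le> t \<and> i \<le> N t \<omega> \<and> t < y" by blast
    qed
    finally show ?thesis using True by auto
  next
    case False
    have empty: "{t. 0 \<le> t \<and> i \<le> N t \<omega>} = {}"
    proof (rule ccontr)
      assume "{t. 0 \<le> t \<and> i \<le> N t \<omega>} \<noteq> {}"
      then obtain t where t: "0 \<le> t" "i \<le> N t \<omega>" by blast
      obtain j :: nat where "t \<le> real j" using real_arch_simple by blast
      then have "N t \<omega> \<le> N (real j) \<omega>" using t(1) \<omega> by (intro count_mono) auto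
      then have "i \<le> N (real j) \<omega>" using t(2) by linarith
      then show False using False \<omega> by blast
    qed
    then have "\<omega> \<notin> ?B" by auto
    moreover have "arrival_time N i \<omega> = Inf {}" unfolding arrival_time_def empty ..
    ultimately show ?thesis using False \<omega> by (cases "Inf {} < y") auto
  qed
  then have "{\<omega> \<in> space M. arrival_time N i \<omega> < y} =
      (if Inf {} < y then ?B \<union> (space M - ?E) else ?B)"
    by auto
  moreover have "?E \<in> sets M"
    by (rule sets.sets_Collect_countable_Ex) simp
  moreover have "?B \<in> sets M"
  proof (rule sets.sets_Collect_countable_Ex)
    fix q :: rat
    show "{\<omega> \<in> space M. 0 \<le> real_of_rat q \<and> real_of_rat q < y \<and> i \<le> N (real_of_rat q) \<omega>} \<in> sets M"
      using sets_count_ge[of "of_rat q" i] by (cases "(0::real) \<le> of_rat q \<and> of_rat q < y") auto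
  qed
  ultimately show "{\<omega> \<in> space M. arrival_time N i \<omega> < y} \<in> sets M"
    by auto
qed

lemma arrival_time_le:
  assumes "0 \<le> t" "i \<le> N t \<omega>"
  shows "arrival_time N i \<omega> \<le> t"
  unfolding arrival_time_def using assms by (intro cInf_lower) (auto intro!: bdd_belowI[of _ 0])

text \<open>The witness \<open>t\<close> excludes the value \<open>Inf {}\<close>, whose sign is
  unknown.\<close>

lemma arrival_time_nonneg:
  assumes "i \<le> N t \<omega>" "0 \<le> t"
  shows "0 \<le> arrival_time N i \<omega>"
  unfolding arrival_time_def using assms by (intro cInf_greatest) auto

lemma arrival_time_mono:
  assumes "k \<le> N t \<omega>" "0 \<le> t" "i \<le> k"
  shows "arrival_time N i \<omega> \<le> arrival_time N k \<omega>"
  unfolding arrival_time_def using assms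
  by (intro cInf_superset_mono) (auto intro!: bdd_belowI[of _ 0])

section \<open>A uniform exponential moment\<close>

text \<open>The bound contains neither \<open>i\<close> nor \<open>rate\<close>; this uniformity is
  what makes the final estimate linear. The time axis is cut at the integers, and the growth rate
  1/4 is beaten by the tail decay rate 1/2.\<close>

lemma nn_integral_exp_arrival_time:
  assumes "1 \<le> rate" "real i \<le> rate"
  shows "(\<integral>\<^sup>+\<omega>. ennreal (exp (arrival_time N i \<omega> / 4)) \<partial>M)
    \<le> ennreal (1 + (\<Sum>j. exp (5 / 4) * exp (- 1 / 4) ^ j))"
proof -
  let ?c = "\<lambda>j::nat. exp (5 / 4) * exp (- 1 / 4 :: real) ^ j"
  let ?A = "\<lambda>j::nat. {\<omega> \<in> space M. N (real j) \<omega> < i}"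
  \<comment> \<open>If \<open>Suc j\<close> is the first integer time with at least \<open>i\<close>
    arrivals, then \<open>\<omega>\<close> lies in \<open>?A j\<close> and the arrival time is at
    most \<open>Suc j\<close>, so \<open>?f j\<close> dominates the integrand.\<close>
  let ?f = "\<lambda>j \<omega>. ennreal (exp (real (Suc j) / 4)) * indicator (?A j) \<omega>"
  have A [measurable]: "?A j \<in> sets M" for j by simp
  have le_suminf: "f j \<le> suminf f" for f :: "nat \<Rightarrow> ennreal" and j
    using sum_le_suminf[of f "{j}"] by simp
  have prob_le: "prob (?A j) \<le> exp (1 - real j / 2)" for j
  proof (cases "j \<le> 2")
    case True
    then have "1 \<le> exp (1 - real j / 2)" by simp
    then show ?thesis using prob_le_1[of "?A j"] by linarith
  next
    case False
    then have "prob (?A j) \<le> exp (real i - rate * real j / 2)"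
      by (intro prob_count_less) simp
    also have "\<dots> \<le> exp (1 - real j / 2)"
    proof -
      \<comment> \<open>Expanded, this reads \<open>rate * (1 - j / 2) \<le> 1 - j / 2\<close>, and
        \<open>i \<le> rate\<close> bounds the exponent by the left side.\<close>
      have "0 \<le> (rate - 1) * (real j / 2 - 1)"
        using False assms(1) by (intro mult_nonneg_nonneg) auto
      then show ?thesis using assms(2) by (simp add: algebra_simps diff_divide_distrib)
    qed
    finally show ?thesis .
  qed
  have integral_f: "(\<integral>\<^sup>+\<omega>. ?f j \<omega> \<partial>M) \<le> ennreal (?c j)" for j
  proof -
    have "(\<integral>\<^sup>+\<omega>. ?f j \<omega> \<partial>M) = ennreal (exp (real (Suc j) / 4) * prob (?A j))"
      by (simp add: nn_integral_cmult_indicator emeasure_eq_measure ennreal_mult')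
    also have "\<dots> \<le> ennreal (exp (real (Suc j) / 4) * exp (1 - real j / 2))"
      using prob_le by (intro ennreal_leI mult_left_mono) auto
    \<comment> \<open>The exponents add up to 5/4 - j/4.\<close>
    also have "exp (real (Suc j) / 4) * exp (1 - real j / 2) = ?c j"
      by (simp add: exp_of_nat_mult[symmetric] exp_add[symmetric] field_simps)
    finally show ?thesis .
  qed
  have "AE \<omega> in M. ennreal (exp (arrival_time N i \<omega> / 4)) \<le> 1 + (\<Sum>j. ?f j \<omega>)"
    using AE_eventually_count_ge[of i]
  proof (rule AE_mp, intro AE_I2 impI)
    fix \<omega> assume \<omega>: "\<omega> \<in> space M" and ex: "\<exists>j::nat. i \<le> N (real j) \<omega>"
    define m where "m = (LEAST j::nat. i \<le> N (real j) \<omega>)"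
    have m: "i \<le> N (real m) \<omega>" unfolding m_def using ex by (rule LeastI_ex)
    then have le: "arrival_time N i \<omega> \<le> real m" by (intro arrival_time_le) auto
    show "ennreal (exp (arrival_time N i \<omega> / 4)) \<le> 1 + (\<Sum>j. ?f j \<omega>)"
    proof (cases m)
      \<comment> \<open>Here the arrival time is at most 0; the summand 1 covers this case.\<close>
      case 0
      then have "ennreal (exp (arrival_time N i \<omega> / 4)) \<le> 1"
        using le by simp
      then show ?thesis by (rule order_trans) simp
    next
      case (Suc j)
      then have "\<not> i \<le> N (real j) \<omega>"
        using not_less_Least[of j "\<lambda>j. i \<le> N (real j) \<omega>"] by (simp add: m_def)
      then have "ennreal (exp (arrival_time N i \<omega> / 4)) \<le> ?f j \<omega>"
        using le Suc \<omega> by (simp add: ennreal_leI)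
      also have "\<dots> \<le> (\<Sum>j. ?f j \<omega>)"
        by (rule le_suminf)
      also have "\<dots> \<le> 1 + (\<Sum>j. ?f j \<omega>)" by simp
      finally show ?thesis .
    qed
  qed
  then have "(\<integral>\<^sup>+\<omega>. ennreal (exp (arrival_time N i \<omega> / 4)) \<partial>M) \<le> (\<integral>\<^sup>+\<omega>. 1 + (\<Sum>j. ?f j \<omega>) \<partial>M)"
    by (rule nn_integral_mono_AE)
  also have "\<dots> = 1 + (\<Sum>j. \<integral>\<^sup>+\<omega>. ?f j \<omega> \<partial>M)"
    by (subst nn_integral_add) (auto simp: nn_integral_suminf emeasure_space_1)
  also have "\<dots> \<le> 1 + (\<Sum>j. ennreal (?c j))"
    using integral_f by (intro add_left_mono suminf_le) auto
  also have "(\<Sum>j. ennreal (?c j)) = ennreal (\<Sum>j. ?c j)"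
    by (intro suminf_ennreal2 summable_mult summable_geometric) auto
  also have "1 + \<dots> = ennreal (1 + (\<Sum>j. ?c j))"
    by (subst ennreal_plus) (auto intro!: suminf_nonneg summable_mult summable_geometric)
  finally show ?thesis .
qed

section \<open>From the last arrival to the total movement\<close>

lemma borel_measurable_MV1_total_movement [measurable]:
  "MV1_total_movement a n x N \<in> borel_measurable M"
  unfolding MV1_total_movement_def total_movement_def MV1_def Let_def by measurable

text \<open>Initial and final positions of all \<open>n\<close> sensors lie between 0 and
  \<open>1 + \<epsilon> + arrival_time N n \<omega>\<close>, so each of the \<open>n\<close>
  summands obeys the same bound. The hypothesis on \<open>N t \<omega>\<close> makes these arrivals
  genuine.\<close>

lemma MV1_total_movement_le:
  assumes "a > 0" "\<epsilon> > 0" "0 \<le> t" "n \<le> N t \<omega>"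
  shows "MV1_total_movement a n ((1 + \<epsilon>) / real n) N \<omega>
    \<le> real n * ((4 * a) powr a * exp ((1 + \<epsilon>) / 4) * exp (arrival_time N n \<omega> / 4))"
proof -
  let ?X = "\<lambda>i. arrival_time N i \<omega>"
  let ?K = "(4 * a) powr a * exp ((1 + \<epsilon>) / 4) * exp (?X n / 4)"
  have term_le: "\<bar>MV1 ((1 + \<epsilon>) / real n) ?X i - ?X i\<bar> powr a \<le> ?K" if i: "i \<in> {1..n}" for i
  proof -
    have "0 \<le> ?X 1" using i assms by (intro arrival_time_nonneg[of _ t]) auto
    moreover have "?X 1 \<le> ?X i" "?X i \<le> ?X n"
      using i assms by (auto intro!: arrival_time_mono[of _ t])
    moreover have "0 \<le> (1 + \<epsilon>) / real n * (real i - 1)"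
      using i assms by (intro mult_nonneg_nonneg) auto
    moreover have "(1 + \<epsilon>) / real n * (real i - 1) \<le> (1 + \<epsilon>) / real n * real n"
      using i assms by (intro mult_left_mono) auto
    moreover have "(1 + \<epsilon>) / real n * real n = 1 + \<epsilon>" using i by simp
    ultimately have dist_le: "\<bar>MV1 ((1 + \<epsilon>) / real n) ?X i - ?X i\<bar> \<le> 1 + \<epsilon> + ?X n"
      and pos: "0 < 1 + \<epsilon> + ?X n"
      using assms(2) unfolding MV1_def by (auto split: if_splits)
    have "\<bar>MV1 ((1 + \<epsilon>) / real n) ?X i - ?X i\<bar> powr a \<le> (1 + \<epsilon> + ?X n) powr a"
      using dist_le assms(1) by (intro powr_mono2) auto
    \<comment> \<open>The rate 1/4 is the one for which the exponential moment was bounded.\<close>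
    also have "\<dots> \<le> (a / (1 / 4)) powr a * exp (1 / 4 * (1 + \<epsilon> + ?X n))"
      using pos assms(1) by (intro powr_le_exp_mult) auto
    also have "\<dots> = ?K"
      by (simp add: exp_add[symmetric] field_simps)
    finally show ?thesis .
  qed
  then show ?thesis
    unfolding MV1_total_movement_def total_movement_def Let_def
    using sum_bounded_above[of "{1..n}" "\<lambda>i. \<bar>MV1 ((1 + \<epsilon>) / real n) ?X i - ?X i\<bar> powr a" ?K]
    by simp
qed

end

section \<open>Integrability and the linear bound\<close>

theorem theorem6:
  fixes \<epsilon> a :: real
    and M :: "nat \<Rightarrow> 'a measure"
    and N :: "nat \<Rightarrow> real \<Rightarrow> 'a \<Rightarrow> nat"
  assumes "\<epsilon> > 0" and "a > 0"
    and "\<And>n. n \<ge> 1 \<Longrightarrow> poisson_process (M n) (real n) (N n)"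
  shows "(\<forall>n\<ge>1. integrable (M n) (MV1_total_movement a n ((1 + \<epsilon>) / real n) (N n))) \<and>
         (\<lambda>n. prob_space.expectation (M n) (MV1_total_movement a n ((1 + \<epsilon>) / real n) (N n)))
           \<in> O(\<lambda>n. real n)"
proof -
  define T where "T n = MV1_total_movement a n ((1 + \<epsilon>) / real n) (N n)" for n
  define C where "C = 1 + (\<Sum>j. exp (5 / 4) * exp (- 1 / 4 :: real) ^ j)"
  define K where "K = (4 * a) powr a * exp ((1 + \<epsilon>) / 4)"
  have "C \<ge> 0"
    unfolding C_def by (intro add_nonneg_nonneg suminf_nonneg summable_mult summable_geometric) auto
  have "K \<ge> 0" unfolding K_def by simp
  have T_nonneg: "0 \<le> T n \<omega>" for n \<omega>
    unfolding T_def MV1_total_movement_def total_movement_def Let_def by (intro sum_nonneg) simp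
  have nn_T: "(\<integral>\<^sup>+\<omega>. ennreal (T n \<omega>) \<partial>M n) \<le> ennreal (real n * K * C)"
    and meas_T: "T n \<in> borel_measurable (M n)" if n: "n \<ge> 1" for n
  proof -
    interpret poisson_process "M n" "real n" "N n" using assms(3) n .
    show "T n \<in> borel_measurable (M n)" unfolding T_def by simp
    have "AE \<omega> in M n. ennreal (T n \<omega>)
        \<le> ennreal (real n * K) * ennreal (exp (arrival_time (N n) n \<omega> / 4))"
      using AE_eventually_count_ge[of n]
    proof (rule AE_mp, intro AE_I2 impI)
      fix \<omega> assume "\<exists>j::nat. n \<le> N n (real j) \<omega>"
      then obtain j :: nat where "n \<le> N n (real j) \<omega>" by blast
      then have "T n \<omega> \<le> real n * K * exp (arrival_time (N n) n \<omega> / 4)"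
        using MV1_total_movement_le[of a \<epsilon> "real j" n \<omega>] assms(1,2)
        unfolding T_def K_def by (simp add: mult_ac)
      then show "ennreal (T n \<omega>)
          \<le> ennreal (real n * K) * ennreal (exp (arrival_time (N n) n \<omega> / 4))"
        using \<open>K \<ge> 0\<close> by (subst ennreal_mult[symmetric]) (auto intro: ennreal_leI)
    qed
    then have "(\<integral>\<^sup>+\<omega>. ennreal (T n \<omega>) \<partial>M n)
        \<le> (\<integral>\<^sup>+\<omega>. ennreal (real n * K) * ennreal (exp (arrival_time (N n) n \<omega> / 4)) \<partial>M n)"
      by (rule nn_integral_mono_AE)
    also have "\<dots> = ennreal (real n * K) * (\<integral>\<^sup>+\<omega>. ennreal (exp (arrival_time (N n) n \<omega> / 4)) \<partial>M n)"
      by (intro nn_integral_cmult) measurable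
    also have "\<dots> \<le> ennreal (real n * K) * ennreal C"
      \<comment> \<open>The moment bound applies with both the rate and the index equal to
        \<open>n\<close>, so \<open>C\<close> does not depend on \<open>n\<close>.\<close>
      unfolding C_def using n by (intro mult_left_mono nn_integral_exp_arrival_time) auto
    also have "\<dots> = ennreal (real n * K * C)"
      using \<open>K \<ge> 0\<close> \<open>C \<ge> 0\<close> by (subst ennreal_mult) auto
    finally show "(\<integral>\<^sup>+\<omega>. ennreal (T n \<omega>) \<partial>M n) \<le> ennreal (real n * K * C)" .
  qed
  \<comment> \<open>This ensures that the expectation is a true mean and not the default value 0 of
    the integral of a nonintegrable function.\<close>
  have "integrable (M n) (T n)" if "n \<ge> 1" for n
    using nn_T[OF that] meas_T[OF that] T_nonneg
    by (intro integrableI_nonneg) (auto simp: le_less_trans)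
  moreover have "integral\<^sup>L (M n) (T n) \<le> K * C * real n" if "n \<ge> 1" for n
  proof -
    have "integral\<^sup>L (M n) (T n) = enn2real (\<integral>\<^sup>+\<omega>. ennreal (T n \<omega>) \<partial>M n)"
      using meas_T[OF that] T_nonneg by (intro integral_eq_nn_integral) auto
    also have "\<dots> \<le> real n * K * C"
      using nn_T[OF that] \<open>K \<ge> 0\<close> \<open>C \<ge> 0\<close> by (intro enn2real_leI) auto
    finally show ?thesis by (simp add: mult_ac)
  qed
  then have "(\<lambda>n. integral\<^sup>L (M n) (T n)) \<in> O(\<lambda>n. real n)"
    using T_nonneg
    \<comment> \<open>A process is given only for \<open>n \<ge> 1\<close>, which is enough for an
      eventual bound.\<close>
    by (intro bigoI[where c = "K * C"] eventually_mono[OF eventually_ge_at_top[of 1]]) simp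
  ultimately show ?thesis unfolding T_def by blast
qed

end
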